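(* Let $G$ be an undirected graph on $n$ vertices with maximum degree at most $d$, and let $p=\frac{1}{2(d+1)}$. Then there is a probability distribution over independent sets $I$ of $G$ (a way to sample a random independent set $I$) such that ${\rm Pr}(v\in I)=p$ for every $v\in V(G)$ and, for every nonempty $S\subseteq V(G)$ and every real $t>0$, \[{\rm Pr}\big(|S\cap I|>p|S|+t\big)<\exp\!\left(-\frac{t^2}{9|S|}\right)\quad\text{and}\quad {\rm Pr}\big(|S\cap I|<p|S|-t\big)<\exp\!\left(-\frac{t^2}{9|S|}\right).\] *)

theory Defs
  imports "HOL-Probability.Probability" "Graph_Theory.Digraph"
begin

text \<open>
  A finite simple undirected graph is an instance of the locale \<^locale>\<open>graph\<close>, which represents each
  edge \<open>{u, v}\<close> by the two arcs \<open>u \<rightarrow> v\<close> and \<open>v \<rightarrow> u\<close>; the degree of a vertex is therefore its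
  \<^const>\<open>out_degree\<close>.
\<close>

definition independent_set :: "('a, 'b) pre_digraph \<Rightarrow> 'a set \<Rightarrow> bool" where
  "independent_set G I \<longleftrightarrow> I \<subseteq> verts G \<and> (\<forall>u\<in>I. \<forall>v\<in>I. \<not> u \<rightarrow>\<^bsub>G\<^esub> v)"

end

theory Submission
  imports Defs
begin

text \<open>
  Reveal the vertices in uniformly random order; a vertex joins \<open>I\<close> if it comes first in its closed
  neighbourhood \<open>N v\<close> and an independent coin of bias \<open>p * card (N v) \<le> 1/2\<close> succeeds.  As long
  as \<open>N w\<close> is entirely unrevealed, the conditional probability of \<open>w \<in> I\<close> is exactly \<open>p\<close>, whatever
  happened before, so \<open>card (S \<inter> I) + p * card (live vertices of S)\<close> is a martingale whose increments
  lie in \<open>[-1/2, 1]\<close>.  If \<open>U\<close> is the unrevealed set, the conditional variance of a step is at most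
  \<open>3/4 * card (S \<inter> U) / card U\<close>, which is \<open>3/4\<close> times the probability that the step reveals a vertex
  of \<open>S\<close>.  Since exactly \<open>card S\<close> steps do so, the compensated exponential
  \<open>exp (\<lambda> M + 2 \<lambda>\<^sup>2 card (S \<inter> U))\<close> is a supermartingale for \<open>\<bar>\<lambda>\<bar> \<le> 1/4\<close>, and Chernoff's bound with
  \<open>\<bar>\<lambda>\<bar> = t / (4 card S)\<close> gives the tail \<open>exp (- t\<^sup>2 / (8 card S))\<close>.
\<close>

section \<open>Bounds for the exponential, and the exponential Markov inequality\<close>

lemma exp_le_quadratic:
  fixes y :: real
  assumes "y \<le> 1"
  shows "exp y \<le> 1 + y + y\<^sup>2"
proof (cases "0 \<le> y")
  case True
  then show ?thesis using assms by (rule exp_bound)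
next
  case False
  \<comment> \<open>For negative \<open>y\<close>, the bound 1 - y <= exp (-y) reduces the claim to
    (1 - y)(1 + y + y^2) = 1 - y^3 >= 1.\<close>
  have "y ^ 3 \<le> 0" using False by (simp add: power3_eq_cube mult_le_0_iff zero_le_mult_iff)
  then have "1 \<le> (1 - y) * (1 + y + y\<^sup>2)"
    by (simp add: algebra_simps power2_eq_square power3_eq_cube)
  also have "\<dots> \<le> exp (- y) * (1 + y + y\<^sup>2)"
  proof (rule mult_right_mono)
    show "1 - y \<le> exp (- y)" using exp_ge_add_one_self[of "- y"] by simp
    have "0 \<le> (1 + 2 * y)\<^sup>2 + 3" by simp
    also have "\<dots> = 4 * (1 + y + y\<^sup>2)" by (simp add: power2_eq_square algebra_simps)
    finally show "0 \<le> 1 + y + y\<^sup>2" by simp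
  qed
  finally show ?thesis by (simp add: exp_minus field_simps)
qed

text \<open>One revelation step: \<open>q\<close> is the coin's bias, \<open>c\<close> marks a live
  vertex of \<open>S\<close>, \<open>x\<close> is \<open>p\<close> times the number of live vertices
  of \<open>S\<close> that die, and \<open>2 * l^2 * e\<close> is the compensator released by
  revealing a vertex of \<open>S\<close>. The quadratic bound on \<open>exp\<close> yields a right
  side linear in \<open>q * c\<close>, \<open>x\<close> and \<open>e\<close>, ready to be summed
  over the revealed vertex.\<close>

lemma bernoulli_step_mgf:
  fixes l q x c e :: real
  assumes l: "\<bar>l\<bar> \<le> 1/4" and q: "0 \<le> q" "q \<le> 1" and x: "0 \<le> x" "x \<le> 1/2"
    and c: "c = 0 \<or> c = 1" and e: "e = 0 \<or> e = 1"
  shows "q * exp (l * (c - x) - 2 * l\<^sup>2 * e) + (1 - q) * exp (l * (- x) - 2 * l\<^sup>2 * e)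
    \<le> 1 + l * (q * c - x) - 2 * l\<^sup>2 * e + 2 * l\<^sup>2 * (q * c + x / 2) + l\<^sup>2 / 2 * e"
proof -
  have l2: "l\<^sup>2 \<le> 1/16"
    using power_mono[OF l, of 2] by (simp add: power2_eq_square)
  have e2: "e\<^sup>2 = e" using e by auto
  have bound: "exp (l * z - 2 * l\<^sup>2 * e)
      \<le> 1 + l * z - 2 * l\<^sup>2 * e + 2 * l\<^sup>2 * z\<^sup>2 + l\<^sup>2 / 2 * e" if z: "\<bar>z\<bar> \<le> 1" for z
  proof -
    define y where "y = l * z - 2 * l\<^sup>2 * e"
    have "\<bar>l * z\<bar> \<le> 1/4 * 1"
      unfolding abs_mult by (rule mult_mono) (use l z in auto)
    moreover have "0 \<le> 2 * l\<^sup>2 * e" using e by auto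
    ultimately have "y \<le> 1" unfolding y_def by linarith
    then have "exp y \<le> 1 + y + y\<^sup>2" by (rule exp_le_quadratic)
    \<comment> \<open>This is (a - b)^2 <= 2 a^2 + 2 b^2; afterwards \<open>l2\<close> turns the
      quartic term into a quadratic one.\<close>
    also have "y\<^sup>2 \<le> 2 * l\<^sup>2 * z\<^sup>2 + 8 * (l\<^sup>2 * l\<^sup>2) * e"
    proof -
      have "y\<^sup>2 + (l * z + 2 * l\<^sup>2 * e)\<^sup>2 = 2 * l\<^sup>2 * z\<^sup>2 + 8 * (l\<^sup>2 * l\<^sup>2) * e\<^sup>2"
        unfolding y_def by algebra
      then show ?thesis unfolding e2
        using zero_le_power2[of "l * z + 2 * l\<^sup>2 * e"] by linarith
    qed
    also have "8 * (l\<^sup>2 * l\<^sup>2) * e \<le> l\<^sup>2 / 2 * e"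
      using mult_left_mono[OF l2, of "l\<^sup>2"] e by auto
    finally show ?thesis unfolding y_def by simp
  qed
  have "q * exp (l * (c - x) - 2 * l\<^sup>2 * e) + (1 - q) * exp (l * (- x) - 2 * l\<^sup>2 * e)
    \<le> q * (1 + l * (c - x) - 2 * l\<^sup>2 * e + 2 * l\<^sup>2 * (c - x)\<^sup>2 + l\<^sup>2 / 2 * e)
      + (1 - q) * (1 + l * (- x) - 2 * l\<^sup>2 * e + 2 * l\<^sup>2 * (- x)\<^sup>2 + l\<^sup>2 / 2 * e)"
    by (intro add_mono mult_left_mono bound) (use q x c in auto)
  also have "\<dots> = 1 + l * (q * c - x) - 2 * l\<^sup>2 * e + 2 * l\<^sup>2 * (q * (c\<^sup>2 - 2 * c * x) + x * x)
      + l\<^sup>2 / 2 * e"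
    by (simp add: field_simps power2_eq_square)
  \<comment> \<open>Second moment of the increment: the cross term is dropped by sign, and x <= 1/2
    makes the square linear.\<close>
  also have "2 * l\<^sup>2 * (q * (c\<^sup>2 - 2 * c * x) + x * x) \<le> 2 * l\<^sup>2 * (q * c + x / 2)"
  proof (rule mult_left_mono)
    have "q * (c\<^sup>2 - 2 * c * x) \<le> q * c" using c q x by (intro mult_left_mono) auto
    moreover have "x * x \<le> x * (1/2)" using x by (intro mult_left_mono) auto
    ultimately show "q * (c\<^sup>2 - 2 * c * x) + x * x \<le> q * c + x / 2" by simp
  qed simp
  finally show ?thesis by simp
qed

lemma prob_ge_le_mgf:
  fixes P :: "'a pmf" and X :: "'a \<Rightarrow> real"
  assumes "finite (set_pmf P)" "\<And>x. x \<in> A \<Longrightarrow> a \<le> X x"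
  shows "measure_pmf.prob P A \<le> measure_pmf.expectation P (\<lambda>x. exp (X x)) / exp a"
proof -
  have "measure_pmf.prob P A \<le> measure_pmf.prob P {x \<in> space (measure_pmf P). exp a \<le> exp (X x)}"
    using assms(2) by (intro measure_pmf.finite_measure_mono) auto
  also have "\<dots> \<le> measure_pmf.expectation P (\<lambda>x. exp (X x)) / exp a"
    by (rule integral_Markov_inequality_measure[where A = "{}"])
       (auto intro: integrable_measure_pmf_finite assms(1))
  finally show ?thesis .
qed

section \<open>Random-order sampling in a system of closed neighbourhoods\<close>

locale nbhd_system =
  fixes V :: "'a set" and N :: "'a \<Rightarrow> 'a set" and p :: real
  assumes finite_V: "finite V"
    and nbhd_subset: "v \<in> V \<Longrightarrow> N v \<subseteq> V"
    and nbhd_refl: "v \<in> V \<Longrightarrow> v \<in> N v"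
    and nbhd_sym: "v \<in> V \<Longrightarrow> w \<in> N v \<Longrightarrow> v \<in> N w"
    and p_nonneg: "0 \<le> p"
    and p_card_nbhd: "v \<in> V \<Longrightarrow> p * card (N v) \<le> 1/2"
begin

text \<open>With \<open>U\<close> unrevealed, these are the vertices that can still come first in
  their neighbourhood, hence can still be selected.\<close>

definition live :: "'a set \<Rightarrow> 'a set" where
  "live U = {w \<in> U. N w \<subseteq> U}"

text \<open>\<open>sample k U\<close> is meant for \<open>card U = k\<close>.\<close>

primrec sample :: "nat \<Rightarrow> 'a set \<Rightarrow> 'a set pmf" where
  "sample 0 U = return_pmf {}"
| "sample (Suc k) U = pmf_of_set U \<bind> (\<lambda>v. bernoulli_pmf (p * card (N v)) \<bind>
     (\<lambda>b. map_pmf (\<lambda>J. if b \<and> v \<in> live U then insert v J else J) (sample k (U - {v}))))"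

lemma live_subset: "live U \<subseteq> U"
  by (auto simp: live_def)

lemma live_V: "live V = V"
  using nbhd_subset by (auto simp: live_def)

text \<open>Revealing \<open>v\<close> kills exactly the live \<open>w\<close> with
  \<open>v \<in> N w\<close>, and by symmetry these are the live members of \<open>N v\<close>,
  including possibly \<open>v\<close> itself.\<close>

lemma live_Diff_singleton:
  assumes "U \<subseteq> V" "v \<in> U"
  shows "live (U - {v}) = live U - N v"
  using assms nbhd_refl nbhd_sym unfolding live_def by blast

lemma finite_set_pmf_sample:
  assumes "finite U" "card U = k"
  shows "finite (set_pmf (sample k U))"
  using assms
proof (induction k arbitrary: U)
  case (Suc k)
  then have "U \<noteq> {}" by auto
  then show ?case using Suc by (simp del: if_image_distrib)
qed simp

text \<open>Containment in \<open>live U\<close> carries the induction: everything selected after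
  \<open>v\<close> lies in \<open>live U - N v\<close>, so it cannot conflict with \<open>v\<close>;
  symmetry of \<open>N\<close> excludes the conflict from the other side.\<close>

lemma sample_support:
  assumes "U \<subseteq> V" "card U = k" "J \<in> set_pmf (sample k U)"
  shows "J \<subseteq> live U \<and> (\<forall>v\<in>J. \<forall>w\<in>J. w \<in> N v \<longrightarrow> w = v)"
  using assms
proof (induction k arbitrary: U J)
  case (Suc k)
  have fin: "finite U" using Suc.prems finite_V finite_subset by blast
  have "U \<noteq> {}" using Suc.prems by auto
  with Suc.prems fin obtain v b J' where v: "v \<in> U" and J': "J' \<in> set_pmf (sample k (U - {v}))"
    and J: "J = (if b \<and> v \<in> live U then insert v J' else J')"
    by (auto simp del: if_image_distrib)
  have sub: "U - {v} \<subseteq> V" and card: "card (U - {v}) = k" using Suc.prems v fin by auto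
  have IH: "J' \<subseteq> live U - N v" "\<forall>x\<in>J'. \<forall>w\<in>J'. w \<in> N x \<longrightarrow> w = x"
    using Suc.IH[OF sub card J'] live_Diff_singleton[OF Suc.prems(1) v] by auto
  have "v \<notin> N x" if "x \<in> J'" for x
    using that IH(1) nbhd_sym[of x v] live_subset[of U] Suc.prems(1) by blast
  then show ?case using IH J by auto
qed simp

text \<open>Total expectation over the first revealed vertex and its coin. The coin is tossed even
  when \<open>v\<close> is not live; both branches then agree.\<close>

lemma expectation_sample_Suc:
  fixes f :: "'a set \<Rightarrow> real"
  assumes "U \<subseteq> V" "card U = Suc k"
  shows "measure_pmf.expectation (sample (Suc k) U) f = (\<Sum>v\<in>U.
      p * card (N v) * measure_pmf.expectation (sample k (U - {v}))
        (\<lambda>J. f (if v \<in> live U then insert v J else J))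
      + (1 - p * card (N v)) * measure_pmf.expectation (sample k (U - {v})) f) / card U"
proof -
  have fin: "finite U" using assms finite_V finite_subset by blast
  have ne: "U \<noteq> {}" using assms by auto
  have fs: "finite (set_pmf (sample k (U - {v})))" if "v \<in> U" for v
    using that fin assms by (intro finite_set_pmf_sample) auto
  have "measure_pmf.expectation (bernoulli_pmf (p * card (N v)) \<bind>
     (\<lambda>b. map_pmf (\<lambda>J. if b \<and> v \<in> live U then insert v J else J) (sample k (U - {v})))) f
     = p * card (N v) * measure_pmf.expectation (sample k (U - {v}))
        (\<lambda>J. f (if v \<in> live U then insert v J else J))
      + (1 - p * card (N v)) * measure_pmf.expectation (sample k (U - {v})) f" if v: "v \<in> U" for v
  proof -
    \<comment> \<open>\<open>bernoulli_pmf\<close> clips its parameter to [0, 1], so the bias must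
      be shown to lie there.\<close>
    have "0 \<le> p * card (N v)" "p * card (N v) \<le> 1"
      using p_nonneg p_card_nbhd[of v] v assms by auto
    then show ?thesis
      using fs[OF v] by (subst pmf_expectation_bind[of UNIV]) (auto simp: UNIV_bool)
  qed
  then show ?thesis
    unfolding sample.simps using fin ne fs
    by (subst pmf_expectation_bind_pmf_of_set)
       (auto simp: divide_inverse_commute sum_distrib_left intro!: sum.cong)
qed

text \<open>Double counting of pairs \<open>w \<in> N v\<close>. A live \<open>w\<close> has all of
  \<open>N w\<close> inside \<open>U\<close>, so each of its neighbours is counted. This balances
  the expected gain against the expected loss in a step.\<close>

lemma sum_card_nbhd_live:
  assumes "U \<subseteq> V"
  shows "(\<Sum>v\<in>U. card (S \<inter> live U \<inter> N v)) = (\<Sum>w\<in>S \<inter> live U. card (N w))"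
proof -
  have fin: "finite U" using assms finite_V finite_subset by blast
  have "(\<Sum>v\<in>U. card (S \<inter> live U \<inter> N v)) = (\<Sum>v\<in>U. card {w \<in> S \<inter> live U. w \<in> N v})"
    by (intro sum.cong arg_cong[where f = card]) auto
  also have "\<dots> = (\<Sum>w\<in>S \<inter> live U. card {v \<in> U. w \<in> N v})"
    unfolding card_eq_sum using fin finite_subset[OF live_subset fin]
    by (intro sum.swap_restrict) auto
  also have "\<dots> = (\<Sum>w\<in>S \<inter> live U. card (N w))"
  proof (intro sum.cong arg_cong[where f = card] refl)
    fix w assume "w \<in> S \<inter> live U"
    then have w: "w \<in> V" "N w \<subseteq> U" using assms by (auto simp: live_def)
    then show "{v \<in> U. w \<in> N v} = N w" using nbhd_sym assms by blast
  qed
  finally show ?thesis .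
qed

text \<open>For live \<open>w\<close>, revealing \<open>w\<close> contributes its bias
  \<open>p * card (N w)\<close>, revealing another member of \<open>N w\<close> contributes 0, and
  each remaining vertex of \<open>U\<close> leaves \<open>w\<close> live and contributes
  \<open>p\<close> by induction. The total is \<open>p * card U\<close>, which explains the choice
  of bias.\<close>

lemma sample_marginal:
  assumes "U \<subseteq> V" "card U = k"
  shows "measure_pmf.prob (sample k U) {J. w \<in> J} = (if w \<in> live U then p else 0)"
  using assms
proof (induction k arbitrary: U)
  case 0
  then have "U = {}" using finite_V finite_subset by fastforce
  then show ?case by (simp add: live_def measure_return)
next
  case (Suc k)
  have fin: "finite U" using Suc.prems finite_V finite_subset by blast
  show ?case
  proof (cases "w \<in> live U")
    case False
    have "{J. w \<in> J} \<inter> set_pmf (sample (Suc k) U) = {}"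
      using sample_support[OF Suc.prems] False by auto
    then have "measure_pmf.prob (sample (Suc k) U) {J. w \<in> J} = 0"
      by (simp add: measure_pmf_zero_iff Int_commute del: sample.simps)
    then show ?thesis using False by (simp del: sample.simps)
  next
    case True
    then have w: "w \<in> U" "N w \<subseteq> U" "w \<in> V" using Suc.prems by (auto simp: live_def)
    have IH: "measure_pmf.expectation (sample k (U - {v})) (\<lambda>J. of_bool (w \<in> J))
        = (if w \<in> N v then 0 else p)" if v: "v \<in> U" for v
    proof -
      have "measure_pmf.prob (sample k (U - {v})) {J. w \<in> J}
          = (if w \<in> live (U - {v}) then p else 0)"
        using Suc.prems v fin by (intro Suc.IH) auto
      moreover have "(\<lambda>J. of_bool (w \<in> J) :: real) = indicator {J. w \<in> J}" by auto
      ultimately show ?thesis using True live_Diff_singleton[OF Suc.prems(1) v] by simp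
    qed
    have nb: "w \<in> N v \<longleftrightarrow> v \<in> N w" if "v \<in> U" for v
      using nbhd_sym[of v w] nbhd_sym[of w v] that w Suc.prems by blast
    have "measure_pmf.prob (sample (Suc k) U) {J. w \<in> J}
        = measure_pmf.expectation (sample (Suc k) U) (\<lambda>J. of_bool (w \<in> J))"
    proof -
      have "(\<lambda>J. of_bool (w \<in> J) :: real) = indicator {J. w \<in> J}" by auto
      then show ?thesis by simp
    qed
    also have "\<dots> = (\<Sum>v\<in>U. (if v = w then p * card (N w) else 0)
        + (if v \<in> N w then 0 else p)) / card U"
      unfolding expectation_sample_Suc[OF Suc.prems]
    proof (intro arg_cong2[where f = "(/)"] sum.cong refl)
      fix v assume v: "v \<in> U"
      show "p * card (N v) * measure_pmf.expectation (sample k (U - {v}))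
          (\<lambda>J. of_bool (w \<in> (if v \<in> live U then insert v J else J)))
        + (1 - p * card (N v)) * measure_pmf.expectation (sample k (U - {v})) (\<lambda>J. of_bool (w \<in> J))
        = (if v = w then p * card (N w) else 0) + (if v \<in> N w then 0 else p)"
      proof (cases "v = w")
        case vw: True
        then show ?thesis using True IH[OF v] nbhd_refl[OF w(3)] by simp
      next
        case False
        \<comment> \<open>Inserting \<open>v\<close> does not affect whether \<open>w\<close> is
          selected, so the two coin branches merge.\<close>
        then have "(\<lambda>J. of_bool (w \<in> (if v \<in> live U then insert v J else J)) :: real)
            = (\<lambda>J. of_bool (w \<in> J))" by auto
        then show ?thesis using False IH[OF v] nb[OF v] by (simp add: algebra_simps)
      qed
    qed
    also have "(\<Sum>v\<in>U. (if v = w then p * card (N w) else 0) + (if v \<in> N w then 0 else p))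
        = p * card (N w) + p * card (U - N w)"
      using fin w by (simp add: sum.distrib sum.If_cases Diff_eq)
    also have "\<dots> = p * card U"
      using card_Diff_subset[OF finite_subset[OF w(2) fin] w(2)] card_mono[OF fin w(2)]
      by (simp add: algebra_simps)
    finally show ?thesis using True Suc.prems by (simp del: sample.simps)
  qed
qed

section \<open>The exponential supermartingale and the tail bounds\<close>

lemma sum_step_mgf_le:
  fixes l :: real
  assumes U: "U \<subseteq> V" and l: "\<bar>l\<bar> \<le> 1/4"
  shows "(\<Sum>v\<in>U. p * card (N v) * exp (l * (of_bool (v \<in> S \<inter> live U) - p * card (S \<inter> live U \<inter> N v))
            - 2 * l\<^sup>2 * of_bool (v \<in> S))
        + (1 - p * card (N v)) * exp (l * (- (p * card (S \<inter> live U \<inter> N v)))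
            - 2 * l\<^sup>2 * of_bool (v \<in> S))) \<le> card U"
    (is "sum ?L U \<le> _")
proof -
  have fin: "finite U" using assms finite_V finite_subset by blast
  define q c x e :: "'a \<Rightarrow> real" where "q v = p * card (N v)" and "c v = of_bool (v \<in> S \<inter> live U)"
    and "x v = p * card (S \<inter> live U \<inter> N v)" and "e v = of_bool (v \<in> S)" for v
  have "sum ?L U \<le> (\<Sum>v\<in>U. 1 + l * (q v * c v - x v) - 2 * l\<^sup>2 * e v
      + 2 * l\<^sup>2 * (q v * c v + x v / 2) + l\<^sup>2 / 2 * e v)"
  proof (rule sum_mono)
    fix v assume "v \<in> U"
    then have v: "v \<in> V" using U by auto
    have "x v \<le> q v" unfolding x_def q_def
      using nbhd_subset[OF v] finite_V p_nonneg
      by (intro mult_left_mono of_nat_mono card_mono) (auto intro: finite_subset)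
    then have "x v \<le> 1/2" "0 \<le> x v" "0 \<le> q v" "q v \<le> 1"
      using p_card_nbhd[OF v] p_nonneg unfolding q_def x_def by auto
    then show "?L v \<le> 1 + l * (q v * c v - x v) - 2 * l\<^sup>2 * e v
      + 2 * l\<^sup>2 * (q v * c v + x v / 2) + l\<^sup>2 / 2 * e v"
      using bernoulli_step_mgf[OF l, of "q v" "x v" "c v" "e v"]
      unfolding q_def x_def c_def e_def by simp
  qed
  also have "\<dots> = card U + l * (sum (\<lambda>v. q v * c v) U - sum x U) - 3/2 * l\<^sup>2 * sum e U
      + 2 * l\<^sup>2 * (sum (\<lambda>v. q v * c v) U + sum x U / 2)"
  proof -
    have "(\<Sum>v\<in>U. 1 + l * (q v * c v - x v) - 2 * l\<^sup>2 * e v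
        + 2 * l\<^sup>2 * (q v * c v + x v / 2) + l\<^sup>2 / 2 * e v)
      = (\<Sum>v\<in>U. 1 + l * (q v * c v) - l * x v - 3/2 * l\<^sup>2 * e v
        + 2 * l\<^sup>2 * (q v * c v) + l\<^sup>2 * x v)"
      by (intro sum.cong) (auto simp: algebra_simps)
    also have "\<dots> = card U + l * (\<Sum>v\<in>U. q v * c v) - l * sum x U - 3/2 * l\<^sup>2 * sum e U
        + 2 * l\<^sup>2 * (\<Sum>v\<in>U. q v * c v) + l\<^sup>2 * sum x U"
      by (simp only: sum.distrib sum_subtractf sum_distrib_left[symmetric]) simp
    finally show ?thesis by (simp add: algebra_simps)
  qed
  \<comment> \<open>Martingale property: by double counting, expected gain and expected loss agree,
    so the term linear in \<open>l\<close> vanishes.\<close>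
  also have "sum x U = sum (\<lambda>v. q v * c v) U"
  proof -
    have "sum x U = p * real (\<Sum>v\<in>U. card (S \<inter> live U \<inter> N v))"
      unfolding x_def by (simp add: sum_distrib_left)
    also have "\<dots> = (\<Sum>w\<in>S \<inter> live U. q w)"
      unfolding sum_card_nbhd_live[OF U] q_def by (simp add: sum_distrib_left)
    also have "\<dots> = sum (\<lambda>v. q v * c v) U"
      using fin live_subset[of U] unfolding c_def by (intro sum.mono_neutral_cong_left) auto
    finally show ?thesis .
  qed
  also have "card U + l * (sum (\<lambda>v. q v * c v) U - sum (\<lambda>v. q v * c v) U) - 3/2 * l\<^sup>2 * sum e U
      + 2 * l\<^sup>2 * (sum (\<lambda>v. q v * c v) U + sum (\<lambda>v. q v * c v) U / 2)
      = card U + 3/2 * l\<^sup>2 * (2 * sum (\<lambda>v. q v * c v) U - sum e U)"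
    by (simp add: algebra_simps)
  also have "\<dots> \<le> card U"
  proof -
    \<comment> \<open>Variance against compensator: bias at most 1/2 and c <= e make the remaining
      second-order term nonpositive.\<close>
    have "2 * sum (\<lambda>v. q v * c v) U \<le> sum e U"
      unfolding sum_distrib_left
    proof (rule sum_mono)
      fix v assume "v \<in> U"
      then have "q v \<le> 1/2" using p_card_nbhd U unfolding q_def by auto
      then show "2 * (q v * c v) \<le> e v" unfolding c_def e_def by auto
    qed
    then have "3/2 * l\<^sup>2 * (2 * sum (\<lambda>v. q v * c v) U - sum e U) \<le> 0"
      by (intro mult_nonneg_nonpos) auto
    then show ?thesis by simp
  qed
  finally show ?thesis .
qed

text \<open>The supermartingale in integrated form, by induction on the number of unrevealed
  vertices. The exponent is the expected future gain plus a variance budget of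
  \<open>2 * l^2\<close> for each unrevealed vertex of \<open>S\<close>.\<close>

lemma sample_mgf:
  fixes l :: real
  assumes "U \<subseteq> V" "card U = k" and l: "\<bar>l\<bar> \<le> 1/4"
  shows "measure_pmf.expectation (sample k U) (\<lambda>J. exp (l * card (S \<inter> J)))
    \<le> exp (l * p * card (S \<inter> live U) + 2 * l\<^sup>2 * card (S \<inter> U))"
  using assms(1,2)
proof (induction k arbitrary: U)
  case 0
  then have "U = {}" using finite_V finite_subset by fastforce
  then show ?case by (simp add: live_def)
next
  case (Suc k)
  have fin: "finite U" using Suc.prems finite_V finite_subset by blast
  have fin_live: "finite (S \<inter> live U)" using finite_subset[OF live_subset fin] by simp
  define W where "W = exp (l * p * card (S \<inter> live U) + 2 * l\<^sup>2 * card (S \<inter> U))"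
  define h where "h v = card (S \<inter> live U \<inter> N v)" for v
  define g where "g v = measure_pmf.expectation (sample k (U - {v})) (\<lambda>J. exp (l * card (S \<inter> J)))" for v
  \<comment> \<open>Revealing \<open>v\<close> lowers the exponent in \<open>W\<close> by
    \<open>l * p * h v\<close>, and by \<open>2 * l^2\<close> more if \<open>v\<close> is in
    \<open>S\<close>.\<close>
  have g_le: "g v \<le> W * exp (l * (- (p * h v)) - 2 * l\<^sup>2 * of_bool (v \<in> S))" if v: "v \<in> U" for v
  proof -
    have "g v \<le> exp (l * p * card (S \<inter> live (U - {v})) + 2 * l\<^sup>2 * card (S \<inter> (U - {v})))"
      unfolding g_def using Suc.prems v fin by (intro Suc.IH) auto
    also have "S \<inter> live (U - {v}) = S \<inter> live U - (S \<inter> live U \<inter> N v)"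
      using live_Diff_singleton[OF Suc.prems(1) v] by auto
    also have "real (card \<dots>) = real (card (S \<inter> live U)) - h v"
      unfolding h_def using fin_live
      by (subst card_Diff_subset) (auto intro!: of_nat_diff card_mono)
    also have "real (card (S \<inter> (U - {v}))) = real (card (S \<inter> U)) - of_bool (v \<in> S)"
    proof (cases "v \<in> S")
      case True
      then have "S \<inter> (U - {v}) = S \<inter> U - {v}" "v \<in> S \<inter> U" using v by auto
      moreover have "card (S \<inter> U) > 0" using calculation(2) fin card_gt_0_iff by blast
      ultimately show ?thesis using True fin by simp
    next
      case False
      then have "S \<inter> (U - {v}) = S \<inter> U" by auto
      then show ?thesis using False by simp
    qed
    also have "exp (l * p * (real (card (S \<inter> live U)) - h v)
        + 2 * l\<^sup>2 * (real (card (S \<inter> U)) - of_bool (v \<in> S)))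
        = W * exp (l * (- (p * h v)) - 2 * l\<^sup>2 * of_bool (v \<in> S))"
      unfolding W_def exp_add[symmetric] by (simp add: algebra_simps)
    finally show ?thesis .
  qed
  \<comment> \<open>Later selections avoid \<open>v\<close>, so inserting it raises the count by
    exactly one when \<open>v\<close> is live and in \<open>S\<close>.\<close>
  have ins: "measure_pmf.expectation (sample k (U - {v}))
        (\<lambda>J. exp (l * card (S \<inter> (if v \<in> live U then insert v J else J))))
      = exp (l * of_bool (v \<in> S \<inter> live U)) * g v" if v: "v \<in> U" for v
  proof -
    have "card (S \<inter> (if v \<in> live U then insert v J else J))
        = of_bool (v \<in> S \<inter> live U) + card (S \<inter> J)" if J: "J \<in> set_pmf (sample k (U - {v}))" for J
    proof -
      have "J \<subseteq> U - {v}"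
        using sample_support[OF _ _ J] Suc.prems v fin live_subset by fastforce
      then have "v \<notin> J" "finite J" using fin finite_subset by auto
      then show ?thesis by auto
    qed
    then have "measure_pmf.expectation (sample k (U - {v}))
        (\<lambda>J. exp (l * card (S \<inter> (if v \<in> live U then insert v J else J))))
      = measure_pmf.expectation (sample k (U - {v}))
        (\<lambda>J. exp (l * of_bool (v \<in> S \<inter> live U)) * exp (l * card (S \<inter> J)))"
      by (intro integral_cong_AE) (auto simp: AE_measure_pmf_iff exp_add[symmetric] algebra_simps)
    then show ?thesis by (simp add: g_def)
  qed
  have "measure_pmf.expectation (sample (Suc k) U) (\<lambda>J. exp (l * card (S \<inter> J)))
      = (\<Sum>v\<in>U. p * card (N v) * (exp (l * of_bool (v \<in> S \<inter> live U)) * g v)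
        + (1 - p * card (N v)) * g v) / card U"
    unfolding expectation_sample_Suc[OF Suc.prems]
    by (intro arg_cong2[where f = "(/)"] sum.cong refl) (simp add: ins g_def)
  also have "\<dots> \<le> (\<Sum>v\<in>U. W * (p * card (N v) *
          exp (l * (of_bool (v \<in> S \<inter> live U) - p * h v) - 2 * l\<^sup>2 * of_bool (v \<in> S))
        + (1 - p * card (N v)) * exp (l * (- (p * h v)) - 2 * l\<^sup>2 * of_bool (v \<in> S)))) / card U"
  proof (intro divide_right_mono sum_mono)
    fix v assume v: "v \<in> U"
    let ?E = "exp (l * (- (p * h v)) - 2 * l\<^sup>2 * of_bool (v \<in> S))"
    have q: "0 \<le> p * card (N v)" "0 \<le> 1 - p * card (N v)"
      using p_nonneg p_card_nbhd[of v] v Suc.prems by auto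
    have "p * card (N v) * (exp (l * of_bool (v \<in> S \<inter> live U)) * g v) + (1 - p * card (N v)) * g v
      \<le> p * card (N v) * (exp (l * of_bool (v \<in> S \<inter> live U)) * (W * ?E))
        + (1 - p * card (N v)) * (W * ?E)"
      using q g_le[OF v] by (intro add_mono mult_left_mono) auto
    also have "\<dots> = W * (p * card (N v) * (exp (l * of_bool (v \<in> S \<inter> live U)) * ?E)
        + (1 - p * card (N v)) * ?E)"
      by (simp add: algebra_simps)
    also have "exp (l * of_bool (v \<in> S \<inter> live U)) * ?E
        = exp (l * (of_bool (v \<in> S \<inter> live U) - p * h v) - 2 * l\<^sup>2 * of_bool (v \<in> S))"
      unfolding exp_add[symmetric] by (simp add: algebra_simps)
    finally show "p * card (N v) * (exp (l * of_bool (v \<in> S \<inter> live U)) * g v)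
        + (1 - p * card (N v)) * g v
      \<le> W * (p * card (N v) *
          exp (l * (of_bool (v \<in> S \<inter> live U) - p * h v) - 2 * l\<^sup>2 * of_bool (v \<in> S))
        + (1 - p * card (N v)) * ?E)" .
  qed simp
  also have "\<dots> \<le> W * card U / card U"
    unfolding sum_distrib_left[symmetric] h_def
    by (intro divide_right_mono mult_left_mono sum_step_mgf_le[OF Suc.prems(1) l]) (auto simp: W_def)
  also have "\<dots> = W" using Suc.prems by simp
  finally show ?case unfolding W_def .
qed

lemma sample_tail:
  fixes t \<sigma> :: real
  assumes S: "S \<subseteq> V" "S \<noteq> {}" and t: "0 < t" "t \<le> card S" and s: "\<sigma> = 1 \<or> \<sigma> = - 1"
  shows "measure_pmf.prob (sample (card V) V) {I. \<sigma> * (real (card (S \<inter> I)) - p * card S) > t}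
    < exp (- (t\<^sup>2 / (9 * real (card S))))"
proof -
  let ?P = "sample (card V) V"
  define m where "m = real (card S)"
  have m: "m > 0" using S finite_V finite_subset unfolding m_def by (auto simp: card_gt_0_iff)
  \<comment> \<open>This minimises 2 l^2 m - |l| t, with value -t^2 / (8 m); the hypothesis
    \<open>t \<le> card S\<close> keeps |l| <= 1/4. The sign \<sigma> selects the tail.\<close>
  define l where "l = \<sigma> * (t / (4 * m))"
  have labs: "\<bar>l\<bar> \<le> 1/4"
    using s t m unfolding l_def m_def by (auto simp: field_simps)
  have "measure_pmf.prob ?P {I. \<sigma> * (real (card (S \<inter> I)) - p * card S) > t}
      \<le> measure_pmf.expectation ?P (\<lambda>I. exp (l * card (S \<inter> I))) / exp (l * p * m + t\<^sup>2 / (4 * m))"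
  proof (rule prob_ge_le_mgf)
    show "finite (set_pmf ?P)" using finite_V by (intro finite_set_pmf_sample) auto
    fix I assume "I \<in> {I. \<sigma> * (real (card (S \<inter> I)) - p * card S) > t}"
    then have "t / (4 * m) * t \<le> t / (4 * m) * (\<sigma> * (real (card (S \<inter> I)) - p * m))"
      using t m by (intro mult_left_mono) (auto simp: m_def)
    then show "l * p * m + t\<^sup>2 / (4 * m) \<le> l * card (S \<inter> I)"
      unfolding l_def by (simp add: algebra_simps power2_eq_square)
  qed
  also have "\<dots> \<le> exp (l * p * m + 2 * l\<^sup>2 * m) / exp (l * p * m + t\<^sup>2 / (4 * m))"
    using sample_mgf[OF order_refl refl labs, of S] S
    by (intro divide_right_mono) (auto simp: live_V m_def Int_absorb2)
  also have "\<dots> = exp (2 * l\<^sup>2 * m - t\<^sup>2 / (4 * m))" by (simp add: exp_diff[symmetric])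
  also have "2 * l\<^sup>2 * m = t\<^sup>2 / (8 * m)"
    using s m unfolding l_def by (auto simp: field_simps power2_eq_square)
  \<comment> \<open>The slack between 8 and 9 makes the inequality strict.\<close>
  also have "exp (t\<^sup>2 / (8 * m) - t\<^sup>2 / (4 * m)) < exp (- (t\<^sup>2 / (9 * m)))"
    using t m by (simp add: field_simps)
  finally show ?thesis unfolding m_def .
qed

end

section \<open>Application to graphs of bounded degree\<close>

theorem theorem4:
  fixes G :: "('a, 'b) pre_digraph" and n d :: nat and p :: real
  assumes "graph G"
    and "card (verts G) = n"
    and "\<forall>v\<in>verts G. out_degree G v \<le> d"
    and "p = 1 / (2 * (real d + 1))"
  shows "\<exists>P :: 'a set pmf.
    (\<forall>I\<in>set_pmf P. independent_set G I) \<and>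
    (\<forall>v\<in>verts G. measure_pmf.prob P {I. v \<in> I} = p) \<and>
    (\<forall>S t. S \<subseteq> verts G \<and> S \<noteq> {} \<and> t > (0::real) \<longrightarrow>
      measure_pmf.prob P {I. real (card (S \<inter> I)) > p * real (card S) + t}
        < exp (- (t\<^sup>2 / (9 * real (card S)))) \<and>
      measure_pmf.prob P {I. real (card (S \<inter> I)) < p * real (card S) - t}
        < exp (- (t\<^sup>2 / (9 * real (card S)))))"
proof -
  interpret graph G by fact
  define N where "N v = insert v {w. v \<rightarrow>\<^bsub>G\<^esub> w}" for v
  have p: "0 \<le> p" "p \<le> 1" using assms(4) by auto
  have cardN: "card (N v) \<le> d + 1" if "v \<in> verts G" for v
  proof -
    have "{w. v \<rightarrow>\<^bsub>G\<^esub> w} \<subseteq> head G ` out_arcs G v" by (auto simp: arcs_ends_conv)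
    then have "card {w. v \<rightarrow>\<^bsub>G\<^esub> w} \<le> card (head G ` out_arcs G v)" by (intro card_mono) auto
    also have "\<dots> \<le> out_degree G v" unfolding out_degree_def 
      by (intro card_image_le finite_out_arcs)
    also have "\<dots> \<le> d" using assms(3) that by simp
    finally show ?thesis unfolding N_def using card_insert_le_m1[of "d + 1"] by simp
  qed
  interpret nbhd_system "verts G" N p
  proof
    fix v assume v: "v \<in> verts G"
    show "N v \<subseteq> verts G" using v by (auto simp: N_def)
    show "v \<in> N v" by (simp add: N_def)
    show "v \<in> N w" if "w \<in> N v" for w
      using that sym_arcs unfolding N_def symmetric_def by (auto dest: symD)
    have "p * card (N v) \<le> p * (real d + 1)"
      using cardN[OF v] p by (intro mult_left_mono) auto
    \<comment> \<open>The value of \<open>p\<close> is the one for which a closed neighbourhood of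
      the maximal size d + 1 gives a fair coin.\<close>
    also have "\<dots> = 1/2" unfolding assms(4) by (simp add: field_simps)
    finally show "p * card (N v) \<le> 1/2" .
  qed (use p in auto)
  let ?P = "sample (card (verts G)) (verts G)"
  have indep: "independent_set G I" if "I \<in> set_pmf ?P" for I
  proof -
    have I: "I \<subseteq> verts G" "\<forall>v\<in>I. \<forall>w\<in>I. w \<in> N v \<longrightarrow> w = v"
      using sample_support[OF order_refl refl that] live_V by auto
    \<comment> \<open>\<open>sample_support\<close> only separates distinct vertices; absence of
      loops settles u = v.\<close>
    have "\<not> u \<rightarrow>\<^bsub>G\<^esub> u" for u using no_loops by (auto simp: arcs_ends_conv)
    then show ?thesis using I unfolding independent_set_def N_def by blast
  qed
  have tail: "measure_pmf.prob ?P {I. \<sigma> * (real (card (S \<inter> I)) - p * card S) > t}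
      < exp (- (t\<^sup>2 / (9 * real (card S))))"
    if S: "S \<subseteq> verts G" "S \<noteq> {}" and t: "t > 0" and s: "\<sigma> = 1 \<or> \<sigma> = - 1" for S t \<sigma>
  proof (cases "t \<le> card S")
    case True
    then show ?thesis using sample_tail S t s by blast
  next
    case False
    \<comment> \<open>For t > \<open>card S\<close> the event is empty, since the count and its mean
      both lie between 0 and \<open>card S\<close>; the right side is still positive.\<close>
    have "\<sigma> * (real (card (S \<inter> I)) - p * card S) \<le> card S" for I
    proof -
      have "real (card (S \<inter> I)) \<le> card S" using S finite_verts finite_subset
        by (intro of_nat_mono card_mono) blast+
      moreover have "0 \<le> p * card S" "p * card S \<le> card S"
        using p by (auto intro: mult_left_le_one_le)
      ultimately show ?thesis using s by auto
    qed
    then have "\<not> \<sigma> * (real (card (S \<inter> I)) - p * card S) > t" for I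
      using False by (meson le_less_trans not_less order_less_imp_le)
    then have "{I. \<sigma> * (real (card (S \<inter> I)) - p * card S) > t} = {}" by blast
    then show ?thesis by simp
  qed
  show ?thesis
  proof (intro exI[of _ ?P] conjI allI impI ballI)
    show "independent_set G I" if "I \<in> set_pmf ?P" for I by (rule indep[OF that])
    show "measure_pmf.prob ?P {I. v \<in> I} = p" if "v \<in> verts G" for v
      using sample_marginal[OF order_refl refl, of v] that by (simp add: live_V)
    fix S t assume "S \<subseteq> verts G \<and> S \<noteq> {} \<and> t > (0::real)"
    then have St: "S \<subseteq> verts G" "S \<noteq> {}" "t > 0" by auto
    show "measure_pmf.prob ?P {I. real (card (S \<inter> I)) > p * real (card S) + t}
        < exp (- (t\<^sup>2 / (9 * real (card S))))"
      using tail[OF St, of 1] by (simp add: algebra_simps)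
    show "measure_pmf.prob ?P {I. real (card (S \<inter> I)) < p * real (card S) - t}
        < exp (- (t\<^sup>2 / (9 * real (card S))))"
      using tail[OF St, of "- 1"] by (simp add: algebra_simps)
  qed
qed

end
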